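(* Let $n$, $k$ and $\ell$ be integers with $k\geq \ell\geq 1$ and $n\geq \ell+2$. Let $G$ be an $n$-vertex graph and let $v_1,\ldots,v_n$ be a labelling of $V(G)$ such that every edge $v_iv_j\in E(G)$ satisfies $|i-j|\leq k$. Suppose that, for each $i\in[n]$, \[ \deg_G(v_i)\geq \min\{\ell+i-1,\ k+\ell,\ k+n-i\}. \] Then $G$ contains a spanning subdivision of $K_{2,\ell}$ rooted at $v_1$ and $v_n$, i.e.\ there exist $\ell$ paths in $G$, each from $v_1$ to $v_n$ and each with at least two edges, which pairwise share no vertices other than $v_1$ and $v_n$, and whose union covers all vertices of $G$.
   Context: A subdivision of a graph $H$ is obtained by replacing each edge of $H$ by a path of positive length, these paths being internally disjoint. A subdivision of $K_{2,\ell}$ rooted at $u,v$ is one in which the two vertices forming the part of size $2$ of $K_{2,\ell}$ are $u$ and $v$. *)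

theory Defs
  imports Graph_Theory.Graph_Theory
begin

text \<open>
  A finite simple graph is a \<open>pair_graph\<close>: a finite, loop-free, symmetric set of arcs.  An edge
  \<open>xy\<close> is the pair of arcs \<open>(x, y)\<close>, \<open>(y, x)\<close>, so the degree of a vertex is its \<open>out_degree\<close>.
\<close>

definition K2_rooted :: "nat \<Rightarrow> 'a \<Rightarrow> 'a \<Rightarrow> 'a pair_pre_digraph \<Rightarrow> bool" where
  "K2_rooted l u v K \<longleftrightarrow>
     (\<exists>W. u \<noteq> v \<and> {u, v} \<inter> W = {} \<and> finite W \<and> card W = l \<and>
          pverts K = {u, v} \<union> W \<and> parcs K = {u, v} \<times> W \<union> W \<times> {u, v})"

text \<open>
  \<open>subdivision_pair K S\<close> keeps the names of the vertices of \<open>K\<close>, so the roots of the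
  subdivision \<open>S\<close> are the vertices \<open>u\<close>, \<open>v\<close> themselves.
\<close>

definition K2_subdivision :: "nat \<Rightarrow> 'a \<Rightarrow> 'a \<Rightarrow> 'a pair_pre_digraph \<Rightarrow> bool" where
  "K2_subdivision l u v S \<longleftrightarrow> (\<exists>K. K2_rooted l u v K \<and> subdivision_pair K S)"

definition has_spanning_K2_subdivision ::
    "nat \<Rightarrow> 'a \<Rightarrow> 'a \<Rightarrow> 'a pair_pre_digraph \<Rightarrow> bool" where
  "has_spanning_K2_subdivision l u v G \<longleftrightarrow>
     (\<exists>S. K2_subdivision l u v S \<and> spanning (with_proj S) (with_proj G))"

lemma K2_rooted_imp_complete_bipartite:
  assumes "K2_rooted l u v K"
  shows "K\<^bsub>2,l\<^esub> (with_proj K)"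
proof -
  obtain W where "u \<noteq> v" "{u, v} \<inter> W = {}" "finite W" "card W = l"
    "pverts K = {u, v} \<union> W" "parcs K = {u, v} \<times> W \<union> W \<times> {u, v}"
    using assms by (auto simp: K2_rooted_def)
  then show ?thesis
    unfolding complete_bipartite_digraph_pair_def
    apply (intro conjI)
     apply simp
    apply (rule exI[of _ "{u, v}"], rule exI[of _ W])
    apply simp
    done
qed


text \<open>The description of such subdivisions by systems of internally disjoint paths.\<close>

definition path_system :: "'a \<Rightarrow> 'a \<Rightarrow> 'a list set \<Rightarrow> bool" where
  "path_system u v P \<longleftrightarrow> finite P \<and>
     (\<forall>p\<in>P. hd p = u \<and> last p = v \<and> distinct p \<and> 3 \<le> length p) \<and>
     (\<forall>p\<in>P. \<forall>q\<in>P. p \<noteq> q \<longrightarrow> set p \<inter> set q = {u, v})"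

definition path_graph :: "'a \<Rightarrow> 'a \<Rightarrow> 'a list set \<Rightarrow> 'a pair_pre_digraph" where
  "path_graph u v P = \<lparr> pverts = {u, v} \<union> (\<Union>p\<in>P. set p),
     parcs = (\<Union>p\<in>P. set (vwalk_arcs p) \<union> (set (vwalk_arcs p))\<inverse>) \<rparr>"

lemma set_vwalk_arcs_split:
  "(a, b) \<in> set (vwalk_arcs p) \<longleftrightarrow> (\<exists>as bs. p = as @ a # b # bs)"
proof (induction p rule: vwalk_arcs.induct)
  case (3 x y xs)
  then show ?case
    by (auto simp: Cons_eq_append_conv)
qed (auto simp: Cons_eq_append_conv)

lemma vwalk_arcs_subdivided:
  "set (vwalk_arcs (as @ a # b # bs)) =
     insert (a, b) (set (vwalk_arcs (as @ [a])) \<union> set (vwalk_arcs (b # bs)))"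
  by (induction as rule: vwalk_arcs.induct) auto

lemma path_system_arc_inner:
  assumes ps: "path_system u v P" and uv: "u \<noteq> v" and p: "p \<in> P"
    and arc: "p = as @ a # b # bs"
  shows "\<not> {a, b} \<subseteq> {u, v}"
proof
  have pp: "hd p = u" "last p = v" "distinct p" "3 \<le> length p"
    using ps p by (auto simp: path_system_def)
  assume "{a, b} \<subseteq> {u, v}"
  moreover have "b \<noteq> u" using pp arc by (cases as) auto
  moreover have "a \<noteq> v" using pp arc by (cases bs rule: rev_cases) auto
  ultimately have "a = u" "b = v" by auto
  have "as = []" using pp arc \<open>a = u\<close> by (cases as) auto
  moreover have "bs = []" using pp arc \<open>b = v\<close> by (cases bs rule: rev_cases) auto
  ultimately show False using pp arc by simp
qed

lemma
  assumes ps: "path_system u v P" and uv: "u \<noteq> v" and p: "p \<in> P"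
    and arc: "p = as @ a # b # bs" and w: "w \<notin> pverts (path_graph u v P)"
  defines "P' \<equiv> insert (as @ a # w # b # bs) (P - {p})"
  shows path_system_subdivide: "path_system u v P'"
    and card_path_system_subdivide: "card P' = card P"
    and path_graph_subdivide: "path_graph u v P' = subdivide (path_graph u v P) (a, b) w"
proof -
  let ?p' = "as @ a # w # b # bs"
  have pp: "hd p = u" "last p = v" "distinct p" "3 \<le> length p"
    using ps p by (auto simp: path_system_def)
  have w': "w \<noteq> u" "w \<noteq> v" "\<And>q. q \<in> P \<Longrightarrow> w \<notin> set q"
    using w by (auto simp: path_graph_def)
  have hd': "hd ?p' = u" using pp arc by (cases as) auto
  have last': "last ?p' = v" using pp arc by simp
  have dist': "distinct ?p'" using pp arc w'(3)[OF p] by auto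
  have set': "set ?p' = insert w (set p)" using arc by auto
  have disj: "set p \<inter> set q = {u, v}" if "q \<in> P - {p}" for q
    using ps p that by (auto simp: path_system_def)
  have disj': "set ?p' \<inter> set q = {u, v}" if "q \<in> P - {p}" for q
    unfolding set' using disj[OF that] w'(3)[of q] that by auto
  have disj'': "set q \<inter> set ?p' = {u, v}" if "q \<in> P - {p}" for q
    using disj'[OF that] by blast
  have old: "\<forall>q\<in>P-{p}. hd q = u \<and> last q = v \<and> distinct q \<and> 3 \<le> length q"
    "\<forall>q\<in>P-{p}. \<forall>r\<in>P-{p}. q \<noteq> r \<longrightarrow> set q \<inter> set r = {u, v}" "finite P"
    using ps by (auto simp: path_system_def)
  have len': "3 \<le> length ?p'" by simp
  show "path_system u v P'"
    unfolding path_system_def P'_def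
    using old disj' disj'' hd' last' dist' len' by (intro conjI) (simp, blast, blast)
  have "?p' \<notin> P" using w'(3)[of ?p'] by auto
  then show "card P' = card P"
    unfolding P'_def using p old(3) by (metis Diff_iff card.remove card_insert_disjoint finite_Diff)
  define A where "A q = set (vwalk_arcs q) \<union> (set (vwalk_arcs q))\<inverse>" for q :: "'a list"
  have nin: "\<not> {a, b} \<subseteq> {u, v}" by (rule path_system_arc_inner[OF ps uv p arc])
  have other: "(a, b) \<notin> A q" "(b, a) \<notin> A q" if "q \<in> P - {p}" for q
  proof -
    have "\<not> {a, b} \<subseteq> set q"
      using disj[OF that] nin arc by auto
    then show "(a, b) \<notin> A q" "(b, a) \<notin> A q"
      by (auto simp: A_def dest: arcs_in_vwalk_arcs)
  qed
  have nself: "(a, b) \<notin> set (vwalk_arcs (as @ [a]))" "(b, a) \<notin> set (vwalk_arcs (as @ [a]))"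
    "(a, b) \<notin> set (vwalk_arcs (b # bs))" "(b, a) \<notin> set (vwalk_arcs (b # bs))"
    using pp(3) unfolding arc by (auto dest!: arcs_in_vwalk_arcs)
  have w3: "set (vwalk_arcs (w # b # bs)) = insert (w, b) (set (vwalk_arcs (b # bs)))" by simp
  have ne: "a \<noteq> w" "b \<noteq> w" "a \<noteq> b" using dist' by auto
  have Ap: "A ?p' = (A p - {(a, b), (b, a)}) \<union> {(a, w), (w, a), (w, b), (b, w)}"
    unfolding A_def arc vwalk_arcs_subdivided w3 using nself ne by auto
  have "(\<Union>q\<in>P'. A q) = A ?p' \<union> (\<Union>q\<in>P-{p}. A q)" by (simp add: P'_def)
  also have "\<dots> = ((A p \<union> (\<Union>q\<in>P-{p}. A q)) - {(a, b), (b, a)}) \<union> {(a, w), (w, a), (w, b), (b, w)}"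
    unfolding Ap using other by blast
  also have "A p \<union> (\<Union>q\<in>P-{p}. A q) = (\<Union>q\<in>P. A q)" using p by blast
  finally have arcs: "(\<Union>q\<in>P'. A q) = ((\<Union>q\<in>P. A q) - {(a, b), (b, a)}) \<union> {(a, w), (w, a), (w, b), (b, w)}" .
  have "(\<Union>q\<in>P'. set q) = insert w (set p) \<union> (\<Union>q\<in>P-{p}. set q)"
    by (simp add: P'_def set'[symmetric])
  also have "\<dots> = insert w (\<Union>q\<in>P. set q)" using p by blast
  finally have verts: "(\<Union>q\<in>P'. set q) = insert w (\<Union>q\<in>P. set q)" .
  show "path_graph u v P' = subdivide (path_graph u v P) (a, b) w"
    unfolding path_graph_def subdivide.simps verts A_def[symmetric] arcs by auto
qed

lemma path_system_form:
  assumes "path_system u v P" "p \<in> P"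
  obtains xs where "p = u # xs @ [v]" "xs \<noteq> []"
proof -
  have pp: "hd p = u" "last p = v" "3 \<le> length p"
    using assms by (auto simp: path_system_def)
  obtain q where "p = u # q" using pp by (cases p) auto
  moreover then obtain xs where "q = xs @ [v]" using pp by (cases q rule: rev_cases) auto
  ultimately show thesis using that pp by (cases xs) auto
qed

lemma K2_rooted_path_graph:
  assumes uv: "u \<noteq> v" and W: "{u, v} \<inter> W = {}" "finite W"
  shows "path_system u v ((\<lambda>w. [u, w, v]) ` W)"
    and "card ((\<lambda>w. [u, w, v]) ` W) = card W"
    and "pverts (path_graph u v ((\<lambda>w. [u, w, v]) ` W)) = {u, v} \<union> W"
    and "parcs (path_graph u v ((\<lambda>w. [u, w, v]) ` W)) = {u, v} \<times> W \<union> W \<times> {u, v}"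
  using assms by (auto simp: path_system_def path_graph_def card_image inj_on_def)

lemma pair_bidirected_K2_rooted:
  assumes "K2_rooted l u v K" shows "pair_bidirected_digraph K"
proof -
  interpret pair_graph K
    using K2_rooted_imp_complete_bipartite[OF assms] by (rule pair_graphI_complete_bipartite)
  show ?thesis by unfold_locales
qed

lemma K2_subdivision_path_graph:
  assumes "path_system u v P" "u \<noteq> v"
  shows "K2_subdivision (card P) u v (path_graph u v P)"
  using assms(1)
proof (induction "\<Sum>p\<in>P. length p" arbitrary: P rule: less_induct)
  case less
  have fin: "finite P" using less.prems by (simp add: path_system_def)
  show ?case
  proof (cases "\<forall>p\<in>P. length p = 3")
    case True
    define W where "W = (\<lambda>p. p ! 1) ` P"
    have form: "p = [u, p ! 1, v] \<and> p ! 1 \<notin> {u, v}" if pP: "p \<in> P" for p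
    proof -
      obtain xs where xs: "p = u # xs @ [v]" "xs \<noteq> []"
        using path_system_form[OF less.prems pP] .
      then obtain x where "p = [u, x, v]" using True pP by (cases xs) auto
      moreover have "distinct p" using less.prems pP by (auto simp: path_system_def)
      ultimately show ?thesis by auto
    qed
    have P: "P = (\<lambda>w. [u, w, v]) ` W"
      unfolding W_def image_image using form by force
    have W: "{u, v} \<inter> W = {}" "finite W" using form fin by (auto simp: W_def)
    have "K2_rooted (card P) u v (path_graph u v P)"
      unfolding K2_rooted_def P using K2_rooted_path_graph[OF assms(2) W] assms(2) W by metis
    then show ?thesis
      unfolding K2_subdivision_def
      by (blast intro: subdivision_pair_base pair_bidirected_K2_rooted)
  next
    case False
    then obtain p where p: "p \<in> P" "length p \<noteq> 3" by auto
    obtain xs where xs: "p = u # xs @ [v]" "xs \<noteq> []"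
      using path_system_form[OF less.prems p(1)] .
    then obtain x y ys where p_eq: "p = u # x # y # ys @ [v]"
      using p(2) by (cases xs; cases "tl xs") auto
    define q where "q = u # y # ys @ [v]"
    define Q where "Q = insert q (P - {p})"
    have ps: "hd p = u" "last p = v" "distinct p"
      using less.prems p by (auto simp: path_system_def)
    have old: "set p \<inter> set r = {u, v}" "set r \<inter> set p = {u, v}" if "r \<in> P" "r \<noteq> p" for r
      using less.prems p that by (auto simp: path_system_def)
    have x: "x \<noteq> u" "x \<noteq> v" "x \<notin> set q" using ps(3) by (auto simp: p_eq q_def)
    have y: "y \<noteq> u" "y \<noteq> v" using ps(3) by (auto simp: p_eq)
    have setp: "set p = insert x (set q)" by (auto simp: p_eq q_def)
    have xr: "x \<notin> set r" if "r \<in> P" "r \<noteq> p" for r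
      using old[OF that] x setp by blast
    have qr: "set q \<inter> set r = {u, v}" "set r \<inter> set q = {u, v}" if "r \<in> P" "r \<noteq> p" for r
      using old[OF that] xr[OF that] by (auto simp: setp)
    have qP: "q \<notin> P"
    proof
      assume "q \<in> P"
      moreover have "q \<noteq> p" by (simp add: q_def p_eq)
      ultimately have "set q = {u, v}" using qr by blast
      then show False using y by (auto simp: q_def)
    qed
    have psQ: "path_system u v Q"
      unfolding path_system_def
    proof (intro conjI ballI impI)
      show "finite Q" using fin by (simp add: Q_def)
    next
      fix r assume r: "r \<in> Q"
      have "distinct q" using ps(3) by (simp add: p_eq q_def)
      moreover have "hd q = u" "last q = v" "3 \<le> length q" by (auto simp: q_def)
      ultimately show "hd r = u" "last r = v" "distinct r" "3 \<le> length r"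
        using r less.prems by (auto simp: Q_def path_system_def)
    next
      fix r s assume "r \<in> Q" "s \<in> Q" "r \<noteq> s"
      then consider "r \<in> P - {p}" "s \<in> P - {p}" | "r = q" "s \<in> P - {p}" | "r \<in> P - {p}" "s = q"
        by (auto simp: Q_def)
      then show "set r \<inter> set s = {u, v}"
      proof cases
        case 1
        then show ?thesis using less.prems \<open>r \<noteq> s\<close> by (auto simp: path_system_def)
      qed (use qr in auto)
    qed
    have xQ: "x \<notin> pverts (path_graph u v Q)"
      using x xr by (auto simp: path_graph_def Q_def)
    have qQ: "q \<in> Q" by (simp add: Q_def)
    have q_split: "q = [] @ u # y # (ys @ [v])" by (simp add: q_def)
    have P_eq: "insert ([] @ u # x # y # (ys @ [v])) (Q - {q}) = P"
      using p(1) qP by (auto simp: Q_def p_eq)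
    note sub = card_path_system_subdivide[OF psQ assms(2) qQ q_split xQ, unfolded P_eq]
      path_graph_subdivide[OF psQ assms(2) qQ q_split xQ, unfolded P_eq]
    have "(\<Sum>p\<in>P. length p) = length p + (\<Sum>r\<in>P-{p}. length r)"
      using fin p(1) by (rule sum.remove)
    moreover have "(\<Sum>r\<in>Q. length r) = length q + (\<Sum>r\<in>P-{p}. length r)"
      unfolding Q_def using fin qP by (subst sum.insert) auto
    moreover have "length q < length p" by (simp add: q_def p_eq)
    ultimately have "(\<Sum>r\<in>Q. length r) < (\<Sum>p\<in>P. length p)" by simp
    from less.hyps[OF this psQ] obtain K where K: "K2_rooted (card P) u v K"
      "subdivision_pair K (path_graph u v Q)"
      by (auto simp: K2_subdivision_def sub(1))
    have "(u, y) \<in> parcs (path_graph u v Q)"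
      using qQ by (auto simp: path_graph_def q_def intro!: bexI[of _ q])
    then have "subdivision_pair K (path_graph u v P)"
      unfolding sub(2) using K(2) xQ by (intro subdivision_pair_divide)
    with K(1) show ?thesis by (auto simp: K2_subdivision_def)
  qed
qed

lemma K2_subdivision_imp_path_graph:
  assumes "K2_subdivision l u v S"
  shows "\<exists>P. path_system u v P \<and> card P = l \<and> S = path_graph u v P"
proof -
  obtain K where K: "K2_rooted l u v K" and sub: "subdivision_pair K S"
    using assms by (auto simp: K2_subdivision_def)
  obtain W where uv: "u \<noteq> v" and W: "{u, v} \<inter> W = {}" "finite W" "card W = l"
    "pverts K = {u, v} \<union> W" "parcs K = {u, v} \<times> W \<union> W \<times> {u, v}"
    using K by (auto simp: K2_rooted_def)
  show ?thesis
    using sub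
  proof (induction rule: subdivision_pair_induct)
    case base
    let ?P = "(\<lambda>w. [u, w, v]) ` W"
    have "K = path_graph u v ?P"
      using W K2_rooted_path_graph[OF uv W(1,2)] by (metis (full_types) pair_pre_digraph.equality old.unit.exhaust)
    then show ?case using W K2_rooted_path_graph[OF uv W(1,2)] by blast
  next
    case (divide e w H)
    then obtain P where P: "path_system u v P" "card P = l" "H = path_graph u v P" by blast
    obtain a b where e: "e = (a, b)" by (cases e)
    from divide.hyps e P obtain p where p: "p \<in> P"
      and "(a, b) \<in> set (vwalk_arcs p) \<or> (b, a) \<in> set (vwalk_arcs p)"
      by (auto simp: path_graph_def)
    then obtain c d as bs where split: "p = as @ c # d # bs"
      and cd: "(c, d) = (a, b) \<or> (c, d) = (b, a)"
      by (auto simp: set_vwalk_arcs_split)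
    have w: "w \<notin> pverts (path_graph u v P)" using divide.hyps P by simp
    have "subdivide H e w = subdivide (path_graph u v P) (c, d) w"
      using cd by (auto simp: e P subdivide.simps)
    then show ?case
      using path_system_subdivide[OF P(1) uv p split w]
        card_path_system_subdivide[OF P(1) uv p split w]
        path_graph_subdivide[OF P(1) uv p split w] P(2) by metis
  qed
qed

theorem has_spanning_K2_subdivision_iff_paths:
  assumes G: "pair_graph G" and uv: "u \<in> pverts G" "v \<in> pverts G" "u \<noteq> v"
  shows "has_spanning_K2_subdivision l u v G \<longleftrightarrow>
    (\<exists>P. finite P \<and> card P = l \<and>
      (\<forall>p\<in>P. vpath p (with_proj G) \<and> hd p = u \<and> last p = v \<and> 2 \<le> vwalk_length p) \<and>
      (\<forall>p\<in>P. \<forall>q\<in>P. p \<noteq> q \<longrightarrow> set p \<inter> set q = {u, v}) \<and>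
      {u, v} \<union> (\<Union>p\<in>P. set p) = pverts G)"
    (is "_ \<longleftrightarrow> ?R")
proof -
  interpret pair_graph G by fact
  show ?thesis
  proof
    assume "has_spanning_K2_subdivision l u v G"
    then obtain S P where S: "spanning (with_proj S) (with_proj G)" "S = path_graph u v P"
      and P: "path_system u v P" "card P = l"
      unfolding has_spanning_K2_subdivision_def using K2_subdivision_imp_path_graph by metis
    have V: "{u, v} \<union> (\<Union>p\<in>P. set p) = pverts G"
      and A: "\<And>p. p \<in> P \<Longrightarrow> set (vwalk_arcs p) \<subseteq> parcs G"
      using S by (auto simp: spanning_def subgraph_def path_graph_def)
    have "vpath p (with_proj G) \<and> hd p = u \<and> last p = v \<and> 2 \<le> vwalk_length p" if "p \<in> P" for p
    proof -
      have "hd p = u" "last p = v" "distinct p" "3 \<le> length p"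
        using P that by (auto simp: path_system_def)
      moreover have "set p \<subseteq> pverts G" using V that by auto
      ultimately show ?thesis using A[OF that] by (auto simp: vpath_def vwalk_def)
    qed
    then show ?R using P V by (intro exI[of _ P]) (auto simp: path_system_def)
  next
    assume ?R
    then obtain P where P: "finite P" "card P = l"
      and path: "\<And>p. p \<in> P \<Longrightarrow> vpath p (with_proj G) \<and> hd p = u \<and> last p = v \<and> 2 \<le> vwalk_length p"
      and disj: "\<And>p q. p \<in> P \<Longrightarrow> q \<in> P \<Longrightarrow> p \<noteq> q \<Longrightarrow> set p \<inter> set q = {u, v}"
      and V: "{u, v} \<union> (\<Union>p\<in>P. set p) = pverts G"
      by metis
    have ps: "path_system u v P"
      unfolding path_system_def using P(1) path disj by (force simp: vpath_def)
    have A: "set (vwalk_arcs p) \<subseteq> parcs G" if "p \<in> P" for p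
      using path[OF that] by (auto simp: vpath_def vwalk_def)
    have "parcs (path_graph u v P) \<subseteq> parcs G"
      using A by (auto simp: path_graph_def intro: arcs_symmetric)
    moreover have "pverts (path_graph u v P) = pverts G"
      using V by (simp add: path_graph_def)
    moreover have "pair_wf_digraph (path_graph u v P)"
      by unfold_locales (auto simp: path_graph_def dest!: arcs_in_vwalk_arcs)
    moreover have "pair_wf_digraph G" by unfold_locales
    ultimately have "spanning (with_proj (path_graph u v P)) (with_proj G)"
      by (simp add: spanning_def subgraph_def wf_digraph_wp_iff compatible_def)
    then show "has_spanning_K2_subdivision l u v G"
      unfolding has_spanning_K2_subdivision_def
      using K2_subdivision_path_graph[OF ps uv(3)] P(2) by blast
  qed
qed

end

theory Submission
  imports Defs
begin

text \<open>
  All \<open>l\<close> paths are grown greedily from \<open>v\<^sub>1\<close>: start them at the \<open>l\<close> smallest neighbours of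
  \<open>v\<^sub>1\<close>, then repeatedly move the smallest current endpoint to its smallest unvisited
  neighbour, or to \<open>v\<^sub>n\<close> if it has none.  When a neighbour \<open>x\<close> of an unvisited vertex \<open>i\<close> is
  left, the path continues below \<open>i\<close>, so a path can only jump over \<open>i\<close> from a non-neighbour of
  \<open>i\<close> in the window of \<open>k\<close> vertices below \<open>i\<close>.  Hence each neighbour of \<open>i\<close> that is used up is paid
  for by a vertex of this window, and as \<open>i\<close> has at least \<open>l\<close> more neighbours than the window has
  vertices, no endpoint gets stuck and no vertex is left over.
\<close>

lemma least_elements:
  fixes A :: "nat set"
  assumes "finite A" "l \<le> card A"
  shows "\<exists>B\<subseteq>A. card B = l \<and> (\<forall>b\<in>B. \<forall>a\<in>A - B. b < a)"
  using assms(2)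
proof (induction l)
  case 0
  then show ?case by (intro exI[of _ "{}"]) auto
next
  case (Suc l)
  then obtain B where B: "B \<subseteq> A" "card B = l" "\<forall>b\<in>B. \<forall>a\<in>A - B. b < a" by auto
  have fin: "finite (A - B)" and fB: "finite B" using assms(1) B(1) finite_subset by auto
  have "card (A - B) > 0" using B Suc.prems fB by (simp add: card_Diff_subset)
  then have ne: "A - B \<noteq> {}" by force
  define m where "m = Min (A - B)"
  have m: "m \<in> A - B" unfolding m_def using fin ne by (rule Min_in)
  have "m < a" if "a \<in> A - B - {m}" for a
    using Min_le[OF fin, of a] that by (auto simp: m_def less_le)
  then show ?case
    using B m fB by (intro exI[of _ "insert m B"]) auto
qed

section \<open>Banded graphs on integer labels and the two degree regimes\<close>

locale banded_graph =
  fixes N :: "nat \<Rightarrow> nat set" and n k l :: nat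
  assumes l_le_k: "l \<le> k" and l_pos: "1 \<le> l" and l_le_n: "l + 2 \<le> n"
    and N_sub: "N i \<subseteq> {1..n}" and N_irrefl: "i \<notin> N i"
    and N_sym: "j \<in> N i \<Longrightarrow> i \<in> N j"
    and N_band: "j \<in> N i \<Longrightarrow> j \<le> i + k"
    and degree: "i \<in> {1..n} \<Longrightarrow> min (l + i - 1) (min (k + l) (k + n - i)) \<le> card (N i)"
begin

definition behind :: "nat \<Rightarrow> nat set" where
  "behind i = {z \<in> {1..n}. z < i \<and> i \<le> z + k}"

text \<open>Unlike \<open>behind i\<close>, this set is unbounded above and contains
  \<open>i\<close>. An endpoint above \<open>i\<close> is counted however far away it is, since its
  path may have got there by jumping over \<open>i\<close>.\<close>

definition reach :: "nat \<Rightarrow> nat set" where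
  "reach i = {z. i \<le> z + k}"

lemma finite_N [simp]: "finite (N i)"
  using N_sub finite_subset by blast

lemma finite_behind [simp]: "finite (behind i)"
  by (simp add: behind_def)

lemma N_band': "j \<in> N i \<Longrightarrow> i \<le> j + k"
  using N_band N_sym by blast

lemma card_behind: "card (behind i) \<le> min k (i - 1)"
proof -
  have "behind i \<subseteq> {i - k..<i}" "behind i \<subseteq> {1..<i}" by (auto simp: behind_def)
  then have "card (behind i) \<le> card {i - k..<i}" "card (behind i) \<le> card {1..<i}"
    by (meson card_mono finite_atLeastLessThan)+
  then show ?thesis by simp
qed

text \<open>For \<open>i\<close> up to \<open>n - l\<close> the term \<open>k + n - i\<close> is at
  least \<open>k + l\<close>, so the degree exceeds the bound of \<open>card_behind\<close> on the
  window by at least \<open>l\<close>.\<close>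

lemma degree_low:
  assumes "1 \<le> i" "i + l \<le> n"
  shows "l + min k (i - 1) \<le> card (N i)"
  using degree[of i] assms by auto

text \<open>The band confines the neighbours of \<open>i\<close> to the window below it and the
  \<open>n - i\<close> labels above it. For the last labels the degree bound reaches the size of
  this set, so the inclusion is an equality.\<close>

lemma full_high:
  assumes "n \<le> i + l" "i \<le> n" "j \<in> {1..n}" "j \<noteq> i" "i \<le> j + k"
  shows "j \<in> N i"
proof -
  have i: "1 \<le> i" using assms l_le_n by simp
  let ?W = "behind i \<union> {i<..n}"
  have sub: "N i \<subseteq> ?W"
  proof
    fix j assume "j \<in> N i"
    then show "j \<in> ?W" using N_sub[of i] N_irrefl[of i] N_band'[of j i]
      by (cases "j < i") (auto simp: behind_def, metis linorder_neqE_nat)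
  qed
  have "card ?W \<le> card (behind i) + card {i<..n}" by (rule card_Un_le)
  moreover have "card {i<..n} = n - i" by simp
  moreover have "min (l + i - 1) (min (k + l) (k + n - i)) \<le> card (N i)"
    using degree[of i] assms(2) i by simp
  \<comment> \<open>From \<open>n \<le> i + l\<close>, the term \<open>l + i - 1\<close> is at least
    \<open>n - 1\<close>, and \<open>k + l\<close> is at least \<open>k + n - i\<close>.\<close>
  moreover have "min k (i - 1) + (n - i) \<le> min (l + i - 1) (min (k + l) (k + n - i))"
    using assms(1,2) i by linarith
  ultimately have "card ?W \<le> card (N i)"
    using card_behind[of i] by linarith
  then have "N i = ?W" using sub by (intro card_seteq) auto
  then show ?thesis using assms by (auto simp: behind_def)
qed

section \<open>The invariant of the greedy process and its preservation\<close>

text \<open>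
  Below, \<open>H\<close> is the set of endpoints of the unfinished paths, \<open>R\<close> the set of unvisited vertices
  other than \<open>n\<close>, and \<open>l - card H\<close> paths have already ended in \<open>n\<close>.  Moving an endpoint preserves
  \<open>rich H R i\<close> for unvisited \<open>i\<close>, and for the vertex moved to.
\<close>

definition rich :: "nat set \<Rightarrow> nat set \<Rightarrow> nat \<Rightarrow> bool" where
  "rich H R i \<longleftrightarrow> card (R \<inter> behind i) + card ((H - {i}) \<inter> reach i) + (l - card H) + 1
     \<le> card (N i \<inter> (R \<union> H \<union> {n}))"

text \<open>
  An endpoint other than the smallest may lose \<open>rich\<close> while it waits, but it lies above all vertices
  that have been left, which serves the same purpose once it becomes the smallest.
\<close>

definition state :: "nat set \<Rightarrow> nat set \<Rightarrow> bool" where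
  "state H R \<longleftrightarrow> H \<subseteq> {2..<n} \<and> R \<subseteq> {2..<n} \<and> H \<inter> R = {} \<and> card H \<le> l
     \<and> (\<forall>i\<in>R. i + l \<le> n \<longrightarrow> rich H R i)
     \<and> (\<forall>h\<in>H. \<forall>h'\<in>H. h < h' \<longrightarrow> (\<forall>z\<in>{1..<n} - H - R. z < h'))
     \<and> (H \<noteq> {} \<longrightarrow> Min H + l \<le> n \<longrightarrow> rich H R (Min H) \<or> (\<forall>z\<in>{1..<n} - H - R. z < Min H))
     \<and> (card H < l \<longrightarrow> (\<forall>i\<in>R. i + l \<le> n))"

text \<open>The largest unvisited vertex has only \<open>n\<close> and unvisited vertices behind it
  as available neighbours. With every path finished, \<open>rich\<close> asks for
  \<open>l + 1\<close> more than the latter.\<close>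

lemma state_final:
  assumes "state {} R" shows "R = {}"
proof (rule ccontr)
  assume ne: "R \<noteq> {}"
  have R: "R \<subseteq> {2..<n}" and low: "\<forall>i\<in>R. i + l \<le> n \<and> rich {} R i"
    using assms l_pos by (auto simp: state_def)
  have fin: "finite R" using R finite_subset by blast
  define i where "i = Max R"
  have i: "i \<in> R" using fin ne by (simp add: i_def)
  then have rich: "rich {} R i" using low by blast
  have "N i \<inter> (R \<union> {n}) \<subseteq> insert n (R \<inter> behind i)"
  proof
    fix j assume j: "j \<in> N i \<inter> (R \<union> {n})"
    have "j < i" if "j \<in> R" using Max_ge[OF fin that] N_irrefl[of i] j by (auto simp: i_def less_le)
    then show "j \<in> insert n (R \<inter> behind i)"
      using j N_band'[of j i] N_sub[of i] by (auto simp: behind_def)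
  qed
  then have "card (N i \<inter> (R \<union> {n})) \<le> card (insert n (R \<inter> behind i))"
    by (intro card_mono) (use fin in auto)
  also have "\<dots> \<le> Suc (card (R \<inter> behind i))" by (simp add: card_insert_le_m1 card_insert_if fin)
  finally show False using rich l_pos by (simp add: rich_def)
qed

text \<open>Otherwise all available neighbours of the smallest endpoint are other endpoints. These
  lie above it, so \<open>rich\<close> has counted them all. If instead every vertex already left
  lies below it, its neighbours number less than \<open>l\<close> plus its window, against the
  degree bound.\<close>

lemma state_next_exists:
  assumes st: "state H R" and ne: "H \<noteq> {}" and none: "N (Min H) \<inter> R = {}"
  shows "n \<in> N (Min H)"
proof (rule ccontr)
  assume nin: "n \<notin> N (Min H)"
  define x where "x = Min H"
  have H: "H \<subseteq> {2..<n}" "card H \<le> l" using st by (auto simp: state_def)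
  have fin: "finite H" using H finite_subset by blast
  have x: "x \<in> H" using fin ne by (simp add: x_def)
  have x2: "2 \<le> x" "x < n" using x H by auto
  have xl: "x + l \<le> n"
    using full_high[of x n] nin x2 l_le_k by (force simp: x_def)
  have sub: "N x \<inter> (R \<union> H \<union> {n}) \<subseteq> H - {x}"
    using none nin N_irrefl by (auto simp: x_def)
  then have le: "card (N x \<inter> (R \<union> H \<union> {n})) \<le> card (H - {x})"
    using fin by (intro card_mono) auto
  have "rich H R x \<or> (\<forall>z\<in>{1..<n} - H - R. z < x)"
    using st ne xl by (simp add: state_def x_def)
  then show False
  proof
    assume "rich H R x"
    moreover have "(H - {x}) \<inter> reach x = H - {x}"
      using Min_le[OF fin] by (force simp: reach_def x_def)
    ultimately show False using le by (simp add: rich_def)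
  next
    assume low: "\<forall>z\<in>{1..<n} - H - R. z < x"
    have "N x \<subseteq> (H - {x}) \<union> behind x"
    proof
      fix j assume j: "j \<in> N x"
      then have "j \<in> {1..n}" "x \<le> j + k" "j \<noteq> x" "j \<noteq> n" "j \<notin> R"
        using subsetD[OF N_sub j] N_band'[OF j] N_irrefl[of x] nin none by (auto simp: x_def)
      then show "j \<in> (H - {x}) \<union> behind x" using low by (auto simp: behind_def)
    qed
    then have "card (N x) \<le> card ((H - {x}) \<union> behind x)" using fin by (intro card_mono) auto
    also have "\<dots> \<le> card (H - {x}) + card (behind x)" by (rule card_Un_le)
    finally have "card (N x) \<le> card (H - {x}) + card (behind x)" .
    moreover have "card (H - {x}) < card H" using fin x by (rule card_Diff1_less)
    ultimately show False
      using degree_low[of x] xl x2 card_behind[of x] H(2) by linarith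
  qed
qed

text \<open>The finished path moves from the count of endpoints in reach to the count
  \<open>l - card H\<close>, and no unvisited vertex loses a neighbour, so both sides of
  \<open>rich\<close> keep their values.\<close>

lemma state_finish:
  assumes st: "state H R" and ne: "H \<noteq> {}" and none: "N (Min H) \<inter> R = {}"
  shows "state (H - {Min H}) R"
proof -
  define x where "x = Min H"
  have H: "H \<subseteq> {2..<n}" "card H \<le> l" "R \<subseteq> {2..<n}" "H \<inter> R = {}"
    using st by (auto simp: state_def)
  have fin: "finite H" using H finite_subset by blast
  have x: "x \<in> H" using fin ne by (simp add: x_def)
  have xlt: "x < h" if "h \<in> H - {x}" for h
    using Min_le[OF fin, of h] that by (auto simp: x_def less_le)
  have xn: "n \<in> N x" using state_next_exists[OF assms] by (simp add: x_def)
  have kx: "n \<le> x + k" using N_band[OF xn] .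
  have top: "z < h'" if "h \<in> H" "h' \<in> H" "h < h'" "z \<in> {1..<n} - H - R" for h h' z
    using st that unfolding state_def by simp
  \<comment> \<open>Every other endpoint is above the endpoint \<open>x\<close>, hence above all
    vertices left before, and now also above the newly left \<open>x\<close>. So the new minimum
    satisfies the second alternative in \<open>state\<close>.\<close>
  have low: "z < h" if "h \<in> H - {x}" "z \<in> {1..<n} - (H - {x}) - R" for h z
    using top[OF x _ xlt[OF that(1)], of z] that xlt[OF that(1)] by (cases "z = x") simp_all
  have cH: "card H = Suc (card (H - {x}))" using fin x by (metis card_Suc_Diff1)
  have "rich (H - {x}) R i" if i: "i \<in> R" "i + l \<le> n" for i
  proof -
    have "rich H R i" using st i by (simp add: state_def)
    moreover have "x \<notin> N i" using none i N_sym by (auto simp: x_def)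
    then have "N i \<inter> (R \<union> (H - {x}) \<union> {n}) = N i \<inter> (R \<union> H \<union> {n})" by auto
    moreover have "i \<notin> H" using i H by auto
    moreover have "x \<in> reach i" using kx i H by (auto simp: reach_def)
    then have "(H \<inter> reach i) = insert x ((H - {x}) \<inter> reach i)" using x by auto
    then have "card (H \<inter> reach i) = Suc (card ((H - {x}) \<inter> reach i))" using fin by simp
    ultimately show ?thesis using cH H(2) by (simp add: rich_def)
  qed
  \<comment> \<open>As \<open>i \<le> n \<le> x + k\<close>, a high \<open>i\<close> would be
    adjacent to \<open>x\<close> by \<open>full_high\<close>, yet \<open>x\<close> has no unvisited
    neighbour.\<close>
  moreover have "i + l \<le> n" if i: "i \<in> R" for i
  proof (rule ccontr)
    assume c: "\<not> i + l \<le> n"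
    have "x \<in> N i"
      using c i x H kx l_le_k by (intro full_high) auto
    then show False using N_sym none i by (auto simp: x_def)
  qed
  moreover have "Min (H - {x}) \<in> H - {x}" if "H - {x} \<noteq> {}"
    using that fin by (intro Min_in) auto
  ultimately show ?thesis
    unfolding state_def x_def[symmetric] using H cH low
    by (intro conjI ballI impI disjI2) auto
qed

text \<open>Losing \<open>x\<close> as a neighbour of \<open>i\<close> is paid for by
  \<open>x\<close> leaving \<open>reach i\<close>. The new endpoint \<open>y\<close> is paid for by
  leaving \<open>R \<inter> behind i\<close>, or by \<open>x\<close> if \<open>y\<close> is above
  \<open>i\<close>. Minimality of \<open>y\<close> prevents \<open>x\<close> from having to pay
  twice.\<close>

lemma state_extend:
  assumes st: "state H R" and ne: "H \<noteq> {}" and some: "N (Min H) \<inter> R \<noteq> {}"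
  defines "y \<equiv> Min (N (Min H) \<inter> R)"
  shows "state (insert y (H - {Min H})) (R - {y})"
proof -
  define x where "x = Min H"
  define H' where "H' = insert y (H - {x})"
  have H: "H \<subseteq> {2..<n}" "card H \<le> l" "R \<subseteq> {2..<n}" "H \<inter> R = {}"
    using st by (auto simp: state_def)
  have fin: "finite H" "finite R" using H finite_subset by blast+
  have x: "x \<in> H" using fin ne by (simp add: x_def)
  have xlt: "x < h" if "h \<in> H - {x}" for h
    using Min_le[OF fin(1), of h] that by (auto simp: x_def less_le)
  have y: "y \<in> N x" "y \<in> R" using Min_in[OF _ some] by (auto simp: y_def x_def)
  have yle: "y \<le> i" if "i \<in> N x" "i \<in> R" for i
    using Min_le[of "N x \<inter> R" i] that by (auto simp: y_def x_def)
  have yH: "y \<notin> H" using y H by auto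
  have xR: "x \<notin> R" using x H by auto
  have Z: "{1..<n} - H' - (R - {y}) = insert x ({1..<n} - H - R)"
    using x y H yH xR by (auto simp: H'_def)
  have top: "z < h'" if "h \<in> H" "h' \<in> H" "h < h'" "z \<in> {1..<n} - H - R" for h h' z
    using st that unfolding state_def by simp
  have low: "z < h" if "h \<in> H - {x}" "z \<in> insert x ({1..<n} - H - R)" for h z
    using top[OF x _ xlt[OF that(1)], of z] that xlt[OF that(1)] by (cases "z = x") simp_all
  have "card H = Suc (card (H - {x}))" using fin x by (metis card_Suc_Diff1)
  then have cH: "card H' = card H" using fin yH by (simp add: H'_def)
  have S: "R - {y} \<union> H' \<union> {n} = (R \<union> H \<union> {n}) - {x}"
    using y x H yH xR by (auto simp: H'_def)
  have lhs: "card (N i \<inter> (R \<union> H \<union> {n})) \<le> card (N i \<inter> (R - {y} \<union> H' \<union> {n})) + (if x \<in> N i then 1 else 0)" for i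
  proof -
    have "card (N i \<inter> (R \<union> H \<union> {n}) - {x}) = card (N i \<inter> (R \<union> H \<union> {n})) - (if x \<in> N i then 1 else 0)"
      using x by (auto simp: card_Diff_singleton_if)
    moreover have "N i \<inter> (R \<union> H \<union> {n}) - {x} = N i \<inter> (R - {y} \<union> H' \<union> {n})"
      unfolding S by auto
    ultimately show ?thesis by simp
  qed
  have Hx: "card (H \<inter> reach i) = card ((H - {x}) \<inter> reach i) + (if x \<in> reach i then 1 else 0)" for i
  proof (cases "x \<in> reach i")
    case True
    then have "H \<inter> reach i = insert x ((H - {x}) \<inter> reach i)" using x by auto
    then show ?thesis using fin True by simp
  next
    case False
    then have "H \<inter> reach i = (H - {x}) \<inter> reach i" by auto
    then show ?thesis using False by simp
  qed
  \<comment> \<open>For \<open>y\<close> itself, \<open>x\<close> is lost both as a neighbour and as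
    an endpoint in reach, and \<open>y\<close> is excluded from its own count of endpoints.\<close>
  have richy: "rich H' (R - {y}) y" if "y + l \<le> n"
  proof -
    have "rich H R y" using st y that by (simp add: state_def)
    moreover have "(R - {y}) \<inter> behind y = R \<inter> behind y" by (auto simp: behind_def)
    moreover have "x \<in> N y" using y N_sym by blast
    moreover have "x \<in> reach y" using y N_band by (auto simp: reach_def)
    moreover have "H' - {y} = H - {x}" "H - {y} = H" using yH by (auto simp: H'_def)
    ultimately show ?thesis using lhs[of y] Hx[of y] cH by (simp add: rich_def)
  qed
  have "rich H' (R - {y}) i" if i: "i \<in> R - {y}" "i + l \<le> n" for i
  proof -
    have r: "rich H R i" using st i by (simp add: state_def)
    have ni: "H - {i} = H" "H' - {i} = H'" using i H by (auto simp: H'_def)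
    have Hy: "card (H' \<inter> reach i) = card ((H - {x}) \<inter> reach i) + (if y \<in> reach i then 1 else 0)"
      using yH fin by (auto simp: H'_def Int_insert_left)
    have Ry: "card (R \<inter> behind i) = card ((R - {y}) \<inter> behind i) + (if y \<in> behind i then 1 else 0)"
    proof (cases "y \<in> behind i")
      case True
      then have "R \<inter> behind i = insert y ((R - {y}) \<inter> behind i)" using y by auto
      then show ?thesis using fin True by simp
    next
      case False
      then have "R \<inter> behind i = (R - {y}) \<inter> behind i" by auto
      then show ?thesis using False by simp
    qed
    have yb: "y \<in> behind i \<longleftrightarrow> y \<in> reach i" if "y < i"
      using that y H by (auto simp: behind_def reach_def)
    show ?thesis
    proof (cases "x \<in> N i")
      case True
      \<comment> \<open>Both \<open>i\<close> and \<open>y\<close> were candidates for the next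
        vertex, so \<open>y\<close> is the smaller and merely passes from the first count in
        \<open>rich\<close> to the second.\<close>
      then have "y < i" using yle[of i] i N_sym by (auto simp: less_le)
      moreover have "x \<in> reach i" using True N_band' by (auto simp: reach_def)
      ultimately show ?thesis
        using r lhs[of i] Hx[of i] Hy Ry yb cH True by (simp add: rich_def ni split: if_splits)
    next
      case False
      show ?thesis
      proof (cases "y < i")
        case True
        then show ?thesis
          using r lhs[of i] Hx[of i] Hy Ry yb cH False by (simp add: rich_def ni split: if_splits)
      next
        case ge: False
        \<comment> \<open>The path jumps to \<open>y\<close> above \<open>i\<close>, which enters
          \<open>reach i\<close> without having been in \<open>behind i\<close>. Since
          \<open>x\<close> is at most \<open>k\<close> below \<open>y\<close>, it was in
          \<open>reach i\<close> and its departure compensates.\<close>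
        then have "x \<in> reach i" using N_band[OF y(1)] by (auto simp: reach_def)
        then show ?thesis
          using r lhs[of i] Hx[of i] Hy Ry cH False by (simp add: rich_def ni split: if_splits)
      qed
    qed
  qed
  moreover have "z < h'" if "h \<in> H'" "h' \<in> H'" "h < h'" "z \<in> insert x ({1..<n} - H - R)" for h h' z
  proof (cases "h' = y")
    case True
    \<comment> \<open>The new endpoint \<open>y\<close> is above an older endpoint \<open>h\<close>,
      which is itself above everything left.\<close>
    then have "h \<in> H - {x}" using that by (auto simp: H'_def)
    then show ?thesis using low that by fastforce
  next
    case False
    then show ?thesis using low that by (auto simp: H'_def)
  qed
  moreover have "rich H' (R - {y}) (Min H') \<or> (\<forall>z\<in>insert x ({1..<n} - H - R). z < Min H')"
    if "Min H' + l \<le> n"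
  proof -
    have "Min H' \<in> H'" using fin by (intro Min_in) (auto simp: H'_def)
    then consider "Min H' = y" | "Min H' \<in> H - {x}" by (auto simp: H'_def)
    then show ?thesis using richy that low by cases auto
  qed
  moreover have "H' \<subseteq> {2..<n}" "H' \<inter> (R - {y}) = {}" "R - {y} \<subseteq> {2..<n}"
    using H y by (auto simp: H'_def)
  moreover have "i + l \<le> n" if "card H' < l" "i \<in> R - {y}" for i
    using st that cH by (simp add: state_def)
  ultimately show ?thesis
    unfolding state_def x_def[symmetric] H'_def[symmetric] Z using cH H(2) by (intro conjI) auto
qed

section \<open>Reading off the paths backwards from the end of the process\<close>

text \<open>\<open>p h\<close> is the still missing part of the path whose current endpoint is
  \<open>h\<close>. The \<open>{n}\<close> on the left of the covering equation accounts for an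
  empty \<open>H\<close>.\<close>

definition linked :: "nat set \<Rightarrow> nat set \<Rightarrow> (nat \<Rightarrow> nat list) \<Rightarrow> bool" where
  "linked H R p \<longleftrightarrow>
     (\<forall>h\<in>H. p h \<noteq> [] \<and> hd (p h) = h \<and> last (p h) = n \<and> distinct (p h) \<and>
        successively (\<lambda>a b. b \<in> N a) (p h)) \<and>
     (\<forall>h\<in>H. \<forall>h'\<in>H. h \<noteq> h' \<longrightarrow> set (p h) \<inter> set (p h') = {n}) \<and>
     (\<Union>h\<in>H. set (p h)) \<union> {n} = H \<union> R \<union> {n}"

text \<open>Each greedy move is undone at the front: the part starting at the smallest endpoint
  \<open>x\<close> is \<open>[x, n]\<close>, or \<open>x\<close> followed by the part starting at
  \<open>y\<close>.\<close>

lemma linked_of_state: "state H R \<Longrightarrow> \<exists>p. linked H R p"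
\<comment> \<open>A move to \<open>y\<close> keeps \<open>card H\<close> and lowers
  \<open>card R\<close>; a move to \<open>n\<close> lowers \<open>card H\<close> and keeps
  \<open>R\<close>.\<close>
proof (induction "card H + 2 * card R" arbitrary: H R rule: less_induct)
  case less
  have H: "H \<subseteq> {2..<n}" "R \<subseteq> {2..<n}" "H \<inter> R = {}"
    using less.prems by (auto simp: state_def)
  have fin: "finite H" "finite R" using H finite_subset by blast+
  show ?case
  proof (cases "H = {}")
    case True
    then have "linked H R (\<lambda>_. [])" using state_final less.prems by (auto simp: linked_def)
    then show ?thesis by blast
  next
    case ne: False
    define x where "x = Min H"
    have x: "x \<in> H" using fin ne by (simp add: x_def)
    have xn: "x \<noteq> n" "x \<notin> R" using x H by auto
    have cH: "card H = Suc (card (H - {x}))" using fin x by (metis card_Suc_Diff1)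
    show ?thesis
    proof (cases "N x \<inter> R = {}")
      case True
      have "n \<in> N x" "state (H - {x}) R"
        using state_next_exists state_finish less.prems ne True by (auto simp: x_def)
      moreover from this obtain p where p: "linked (H - {x}) R p"
        using less.hyps[of "H - {x}" R] cH by auto
      have cov: "(\<Union>h\<in>H - {x}. set (p h)) \<union> {n} = (H - {x}) \<union> R \<union> {n}"
        using p by (simp add: linked_def)
      have "set [x, n] \<inter> set (p h) = {n}" "set (p h) \<inter> set [x, n] = {n}" if "h \<in> H - {x}" for h
      proof -
        have "n \<in> set (p h)" using p that last_in_set[of "p h"] by (auto simp: linked_def)
        moreover have "x \<notin> set (p h)" using cov that xn by auto
        ultimately show "set [x, n] \<inter> set (p h) = {n}" "set (p h) \<inter> set [x, n] = {n}" by auto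
      qed
      moreover have "(\<Union>h\<in>H. set ((p(x := [x, n])) h)) \<union> {n} = H \<union> R \<union> {n}"
      proof -
        have "(\<Union>h\<in>H. set ((p(x := [x, n])) h)) \<union> {n}
            = insert x ((\<Union>h\<in>H - {x}. set (p h)) \<union> {n})"
          using x by (auto split: if_splits)
        then show ?thesis unfolding cov using x by auto
      qed
      ultimately have "linked H R (p(x := [x, n]))"
        using p xn unfolding linked_def by (simp split: if_splits)
      then show ?thesis by blast
    next
      case some: False
      define y where "y = Min (N x \<inter> R)"
      have y: "y \<in> N x" "y \<in> R" using Min_in[OF _ some] by (auto simp: y_def)
      have yH: "y \<notin> H" "y \<noteq> n" using y H by auto
      define H' where "H' = insert y (H - {x})"
      have "state H' (R - {y})"
        using state_extend[of H R] less.prems ne some by (simp add: x_def y_def H'_def)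
      moreover have "card H' = card H" using fin cH yH by (simp add: H'_def)
      moreover have "card (R - {y}) < card R" using fin y by (intro card_Diff1_less)
      ultimately obtain p where p: "linked H' (R - {y}) p"
        using less.hyps[of H' "R - {y}"] by auto
      have cov: "(\<Union>h\<in>H'. set (p h)) \<union> {n} = H' \<union> (R - {y}) \<union> {n}"
        using p by (simp add: linked_def)
      have xp: "x \<notin> set (p h)" if "h \<in> H'" for h
        using cov that xn y by (auto simp: H'_def)
      have py: "p y \<noteq> []" "hd (p y) = y" "last (p y) = n" "distinct (p y)"
        "successively (\<lambda>a b. b \<in> N a) (p y)"
        and ph: "\<And>h. h \<in> H - {x} \<Longrightarrow> p h \<noteq> [] \<and> hd (p h) = h \<and> last (p h) = n \<and> distinct (p h) \<and>
          successively (\<lambda>a b. b \<in> N a) (p h)"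
        using p by (simp_all add: linked_def H'_def)
      have pd: "\<And>h h'. h \<in> H' \<Longrightarrow> h' \<in> H' \<Longrightarrow> h \<noteq> h' \<Longrightarrow> set (p h) \<inter> set (p h') = {n}"
        using p unfolding linked_def by simp
      have dis: "set (x # p y) \<inter> set (p h) = {n}" "set (p h) \<inter> set (x # p y) = {n}"
        if "h \<in> H - {x}" for h
      proof -
        have "h \<in> H'" "y \<in> H'" "h \<noteq> y" using that yH by (auto simp: H'_def)
        then show "set (x # p y) \<inter> set (p h) = {n}" "set (p h) \<inter> set (x # p y) = {n}"
          using pd[of y h] pd[of h y] xp[of h] by auto
      qed
      have "(\<Union>h\<in>H. set ((p(x := x # p y)) h)) \<union> {n} = H \<union> R \<union> {n}"
      proof -
        have "(\<Union>h\<in>H. set ((p(x := x # p y)) h)) \<union> {n}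
            = insert x ((\<Union>h\<in>H'. set (p h)) \<union> {n})"
          using x by (auto simp: H'_def split: if_splits)
        then show ?thesis unfolding cov using x y by (auto simp: H'_def)
      qed
      moreover have "successively (\<lambda>a b. b \<in> N a) (x # p y)"
        using py y by (cases "p y") auto
      moreover have "distinct (x # p y)" using py xp[of y] by (simp add: H'_def)
      moreover have "set (p h) \<inter> set (p h') = {n}" if "h \<in> H - {x}" "h' \<in> H - {x}" "h \<noteq> h'" for h h'
        using pd[of h h'] that by (auto simp: H'_def)
      ultimately have "linked H R (p(x := x # p y))"
        using py ph dis x unfolding linked_def by (simp del: set_simps)
      then show ?thesis by blast
    qed
  qed
qed

section \<open>The starting vertices\<close>

text \<open>\<open>H\<close> consists of the \<open>l\<close> smallest neighbours of 1 other than
  \<open>n\<close>. An unvisited vertex adjacent to 1 has then lost that neighbour, but has no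
  starting vertex above it.\<close>

lemma state_initial:
  obtains H where "H \<subseteq> N 1" "card H = l" "state H ({2..<n} - H)"
proof -
  have "l \<le> card (N 1 - {n})"
  proof (cases "n \<in> N 1")
    case True
    then have kn: "n \<le> 1 + k" using N_band by blast
    \<comment> \<open>These \<open>l\<close> labels are high enough for \<open>full_high\<close>,
      and \<open>n \<le> 1 + k\<close> puts them in the band of 1.\<close>
    have "{n - l..<n} \<subseteq> N 1 - {n}"
    proof
      fix j assume j: "j \<in> {n - l..<n}"
      have "1 \<in> N j" using j kn l_le_n by (intro full_high) auto
      then show "j \<in> N 1 - {n}" using j N_sym by auto
    qed
    then have "card {n - l..<n} \<le> card (N 1 - {n})" by (intro card_mono) auto
    then show ?thesis using l_le_n by simp
  next
    case False
    then show ?thesis using degree_low[of 1] l_le_n by simp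
  qed
  then obtain H where H: "H \<subseteq> N 1 - {n}" "card H = l"
    and first: "\<forall>h\<in>H. \<forall>a\<in>N 1 - {n} - H. h < a"
    using least_elements[of "N 1 - {n}" l] by auto
  have H2: "H \<subseteq> {2..<n}"
  proof
    fix h assume "h \<in> H"
    then have "h \<in> {1..n}" "h \<noteq> 1" "h \<noteq> n" using H(1) N_sub[of 1] N_irrefl[of 1] by auto
    then show "h \<in> {2..<n}" by auto
  qed
  have fin: "finite H" using H2 finite_subset by blast
  define R where "R = {2..<n} - H"
  have Z: "{1..<n} - H - R = {1}" using H2 l_le_n by (auto simp: R_def)
  have "rich H R i" if i: "i \<in> R" "i + l \<le> n" for i
  proof -
    have i2: "2 \<le> i" "i < n" "i \<notin> H" using i by (auto simp: R_def)
    have S: "N i \<inter> (R \<union> H \<union> {n}) = N i - {1}"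
      using N_sub[of i] H2 l_le_n by (auto simp: R_def)
    have deg: "l + min k (i - 1) \<le> card (N i)" using degree_low i i2 by simp
    \<comment> \<open>Endpoints in reach lie behind or above \<open>i\<close>. Those behind fill up,
      together with \<open>R\<close>, the window without the vertex 1.\<close>
    have "card (R \<inter> behind i) + card ((H - {i}) \<inter> reach i) \<le>
      card (R \<inter> behind i) + (card (H \<inter> behind i) + card (H \<inter> {i<..}))"
    proof -
      have "(H - {i}) \<inter> reach i \<subseteq> (H \<inter> behind i) \<union> (H \<inter> {i<..})"
        using H2 by (auto simp: behind_def reach_def)
      then have "card ((H - {i}) \<inter> reach i) \<le> card ((H \<inter> behind i) \<union> (H \<inter> {i<..}))"
        using fin by (intro card_mono) auto
      also have "\<dots> \<le> card (H \<inter> behind i) + card (H \<inter> {i<..})" by (rule card_Un_le)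
      finally show ?thesis by simp
    qed
    also have "\<dots> = card (behind i - {1}) + card (H \<inter> {i<..})"
    proof -
      have "behind i - {1} = (R \<inter> behind i) \<union> (H \<inter> behind i)"
        using H2 i2 by (auto simp: R_def behind_def)
      moreover have "(R \<inter> behind i) \<inter> (H \<inter> behind i) = {}" by (auto simp: R_def)
      ultimately show ?thesis using fin by (simp add: card_Un_disjoint)
    qed
    finally have rhs: "card (R \<inter> behind i) + card ((H - {i}) \<inter> reach i) \<le>
      card (behind i - {1}) + card (H \<inter> {i<..})" .
    have hk: "h \<le> 1 + k" if "h \<in> H" for h using that H(1) N_band by blast
    have b1: "card (behind i - {1}) \<le> card (behind i)" by (intro card_mono) auto
    have b2: "card (behind i - {1}) \<le> i - 2"
    proof -
      have "card (behind i - {1}) \<le> card {2..<i}" by (intro card_mono) (auto simp: behind_def)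
      then show ?thesis by simp
    qed
    have "card (behind i - {1}) + card (H \<inter> {i<..}) + 1 \<le> card (N i - {1})"
    proof (cases "1 \<in> N i")
      case True
      then have "i \<in> N 1" using N_sym by blast
      then have "h < i" if "h \<in> H" for h using first i2 that by simp
      then have "H \<inter> {i<..} = {}" using less_asym by blast
      moreover have "i \<le> 1 + k" using True N_band' by blast
      moreover have "card (N i - {1}) = card (N i) - 1" using True by simp
      ultimately show ?thesis using deg b2 i2 l_pos by simp
    next
      case False
      then have c: "card (N i - {1}) = card (N i)" by simp
      show ?thesis
      proof (cases "i \<le> k")
        case True
        \<comment> \<open>All \<open>l\<close> starting vertices may lie above \<open>i\<close>. The
          window without 1 has at most \<open>i - 2\<close> elements, and
          \<open>(i - 2) + l + 1\<close> is exactly the degree bound.\<close>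
        have "card (H \<inter> {i<..}) \<le> card H" using fin by (intro card_mono) auto
        then show ?thesis using deg b2 i2 c True H(2) by simp
      next
        case False
        then have "H \<inter> {i<..} = {}" using hk by fastforce
        moreover have "card (behind i - {1}) + 1 \<le> card (N i)"
          using deg b1 card_behind[of i] l_pos by linarith
        ultimately show ?thesis using c by simp
      qed
    qed
    then show ?thesis unfolding rich_def S using rhs H(2) by simp
  qed
  moreover have "Min H \<in> H" if "H \<noteq> {}" using that fin by simp
  ultimately have "state H R"
    unfolding state_def Z using H2 H(2) by (intro conjI) (auto simp: R_def, force+)
  then show thesis using that[of H] H by (auto simp: R_def)
qed

end

section \<open>Transfer to the given graph through its labelling\<close>

theorem theorem4:
  fixes G :: "'a pair_pre_digraph" and v :: "nat \<Rightarrow> 'a" and n k l :: nat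
  assumes "pair_graph G"
    and "k \<ge> l" and "l \<ge> 1" and "n \<ge> l + 2"
    and "card (pverts G) = n"
    and "bij_betw v {1..n} (pverts G)"
    and "\<And>i j. i \<in> {1..n} \<Longrightarrow> j \<in> {1..n} \<Longrightarrow> (v i, v j) \<in> parcs G \<Longrightarrow>
           \<bar>int i - int j\<bar> \<le> int k"
    and "\<And>i. i \<in> {1..n} \<Longrightarrow>
           out_degree (with_proj G) (v i) \<ge> Min {l + i - 1, k + l, k + n - i}"
  shows "has_spanning_K2_subdivision l (v 1) (v n) G"
proof -
  interpret pair_graph G by fact
  have inj: "inj_on v {1..n}" and img: "v ` {1..n} = pverts G"
    using assms(6) by (auto simp: bij_betw_def)
  \<comment> \<open>Requiring \<open>i \<in> {1..n}\<close> makes \<open>N i\<close> empty outside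
    the labels, so the locale assumptions hold for all naturals.\<close>
  define N where "N i = {j \<in> {1..n}. i \<in> {1..n} \<and> (v i, v j) \<in> parcs G}" for i
  have deg: "out_degree (with_proj G) (v i) = card (N i)" if i: "i \<in> {1..n}" for i
  proof -
    have "out_arcs (with_proj G) (v i) = (\<lambda>j. (v i, v j)) ` N i"
    proof
      show "out_arcs (with_proj G) (v i) \<subseteq> (\<lambda>j. (v i, v j)) ` N i"
      proof
        fix e assume "e \<in> out_arcs (with_proj G) (v i)"
        then obtain w where w: "e = (v i, w)" "(v i, w) \<in> parcs G"
          by (cases e) (auto simp: out_arcs_def)
        then have "w \<in> v ` {1..n}" unfolding img by (auto dest: in_arcsD2)
        then show "e \<in> (\<lambda>j. (v i, v j)) ` N i" using w i by (auto simp: N_def)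
      qed
    qed (auto simp: N_def out_arcs_def)
    moreover have "inj_on (\<lambda>j. (v i, v j)) (N i)"
    proof (rule inj_onI)
      fix a b
      assume "a \<in> N i" "b \<in> N i" "(v i, v a) = (v i, v b)"
      then have "a \<in> {1..n}" "b \<in> {1..n}" "v a = v b" by (simp_all add: N_def)
      then show "a = b" using inj_onD[OF inj] by blast
    qed
    ultimately show ?thesis by (simp add: out_degree_def card_image)
  qed
  interpret banded_graph N n k l
  proof
    fix i j
    show "i \<notin> N i" using no_loops[of "(v i, v i)"] by (auto simp: N_def)
    show "i \<in> N j" if "j \<in> N i" using that by (auto simp: N_def intro: arcs_symmetric)
    show "j \<le> i + k" if "j \<in> N i" using assms(7)[of i j] that by (auto simp: N_def)
    show "min (l + i - 1) (min (k + l) (k + n - i)) \<le> card (N i)" if "i \<in> {1..n}"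
      using assms(8)[OF that] deg[OF that] by simp
  qed (use assms in \<open>auto simp: N_def\<close>)
  obtain H where H: "H \<subseteq> N 1" "card H = l" "state H ({2..<n} - H)"
    by (rule state_initial)
  then obtain p where p: "linked H ({2..<n} - H) p" using linked_of_state by blast
  have H2: "H \<subseteq> {2..<n}" using H(3) by (simp add: state_def)
  have path: "p h \<noteq> []" "hd (p h) = h" "last (p h) = n" "distinct (p h)"
    "successively (\<lambda>a b. b \<in> N a) (p h)" if "h \<in> H" for h
    using p that by (auto simp: linked_def)
  have disj: "set (p h) \<inter> set (p h') = {n}" if "h \<in> H" "h' \<in> H" "h \<noteq> h'" for h h'
    using p that by (auto simp: linked_def)
  have cov: "(\<Union>h\<in>H. set (p h)) \<union> {n} = {2..n}"
    using p H2 l_le_n by (auto simp: linked_def)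
  have sub: "set (p h) \<subseteq> {2..n}" if "h \<in> H" for h using cov that by blast
  define q where "q h = map v (1 # p h)" for h
  have arcs: "set (vwalk_arcs (map v xs)) \<subseteq> parcs G" if "successively (\<lambda>a b. b \<in> N a) xs" for xs
    using that by (induction xs rule: vwalk_arcs.induct) (auto simp: N_def)
  have set_q: "set (q h) = v ` insert 1 (set (p h))" for h by (simp add: q_def)
  have qpath: "vpath (q h) (with_proj G) \<and> hd (q h) = v 1 \<and> last (q h) = v n \<and> 2 \<le> vwalk_length (q h)"
    if h: "h \<in> H" for h
  proof -
    have s: "insert 1 (set (p h)) \<subseteq> {1..n}" using sub[OF h] l_le_n by auto
    have "distinct (1 # p h)" using path[OF h] sub[OF h] by auto
    then have "distinct (q h)" unfolding q_def distinct_map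
      using inj_on_subset[OF inj, of "set (1 # p h)"] s by simp
    moreover have "set (q h) \<subseteq> pverts G" unfolding set_q img[symmetric] using s by blast
    moreover have "successively (\<lambda>a b. b \<in> N a) (1 # p h)"
      using path[OF h] H(1) h by (cases "p h") auto
    then have "set (vwalk_arcs (q h)) \<subseteq> parcs G" unfolding q_def by (rule arcs)
    \<comment> \<open>So \<open>p h\<close> is not just \<open>[n]\<close>, and prefixing 1 gives at
      least two edges.\<close>
    moreover have "h \<noteq> n" using H2 h by auto
    then have "2 \<le> length (p h)" using path[OF h] by (cases "p h"; cases "tl (p h)") auto
    ultimately show ?thesis
      using path[OF h] by (auto simp: vpath_def vwalk_def q_def last_map)
  qed
  have qdisj: "set (q h) \<inter> set (q h') = {v 1, v n}" if "h \<in> H" "h' \<in> H" "h \<noteq> h'" for h h'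
  proof -
    have "set (q h) \<inter> set (q h') = v ` (insert 1 (set (p h)) \<inter> insert 1 (set (p h')))"
      unfolding set_q using sub that l_le_n
      by (intro inj_on_image_Int[OF inj, symmetric]) force+
    also have "insert 1 (set (p h)) \<inter> insert 1 (set (p h')) = {1, n}" using disj[OF that] by blast
    finally show ?thesis by simp
  qed
  have vin: "v 1 \<in> pverts G" "v n \<in> pverts G" using img l_le_n by auto
  have vne: "v 1 \<noteq> v n" using inj_onD[OF inj, of 1 n] l_le_n by auto
  have "inj_on q H"
  proof (rule inj_onI, rule ccontr)
    fix h h' assume a: "h \<in> H" "h' \<in> H" "q h = q h'" "h \<noteq> h'"
    then have "v h \<in> set (q h)" "v h \<in> set (q h')"
      using path[OF a(1)] hd_in_set[of "p h"] by (auto simp: set_q simp flip: a(3))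
    then have "v h \<in> {v 1, v n}" using qdisj a by blast
    then show False using inj_onD[OF inj, of h 1] inj_onD[OF inj, of h n] H2 a(1) l_le_n by fastforce
  qed
  moreover have "finite H" using H2 finite_subset by blast
  moreover have "{v 1, v n} \<union> (\<Union>h\<in>H. set (q h)) = pverts G"
  proof -
    have "{v 1, v n} \<union> (\<Union>h\<in>H. set (q h)) = v ` insert 1 ((\<Union>h\<in>H. set (p h)) \<union> {n})"
      by (auto simp: set_q)
    also have "insert 1 ((\<Union>h\<in>H. set (p h)) \<union> {n}) = {1..n}" unfolding cov using l_le_n by auto
    finally show ?thesis using img by simp
  qed
  moreover have "\<forall>p\<in>q ` H. \<forall>p'\<in>q ` H. p \<noteq> p' \<longrightarrow> set p \<inter> set p' = {v 1, v n}"
    using qdisj by blast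
  moreover have "\<forall>p\<in>q ` H. vpath p (with_proj G) \<and> hd p = v 1 \<and> last p = v n \<and> 2 \<le> vwalk_length p"
    using qpath by blast
  ultimately have "\<exists>P. finite P \<and> card P = l \<and>
      (\<forall>p\<in>P. vpath p (with_proj G) \<and> hd p = v 1 \<and> last p = v n \<and> 2 \<le> vwalk_length p) \<and>
      (\<forall>p\<in>P. \<forall>q\<in>P. p \<noteq> q \<longrightarrow> set p \<inter> set q = {v 1, v n}) \<and>
      {v 1, v n} \<union> (\<Union>p\<in>P. set p) = pverts G"
    using H(2) by (intro exI[of _ "q ` H"]) (simp add: card_image)
  then show ?thesis
    using has_spanning_K2_subdivision_iff_paths[OF assms(1) vin vne] by blast
qed

end
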